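(* If the series $\sum_{n=1}^{\infty} \frac{1}{n^3\cdot \sin(n)^2}$ (the Flint Hills series, with $n$ in radians) converges, then $\mu(\pi) \leq \frac{5}{2}$, where $\mu(\pi)$ is the irrationality measure of $\pi$.
   Context: The irrationality measure $\mu(x)$ of a positive real number $x$ is the infimum of those $m$ for which the inequality $0 < \left|x - \frac{p}{q}\right| < \frac{1}{q^m}$ holds only for a finite number of pairs of co-prime positive integers $p$ and $q$. If no such $m$ exists, then $\mu(x) = +\infty$. *)

theory Defs
  imports Complex_Main "HOL-Library.Extended_Real"
begin

text \<open>
  The exponent \<open>m\<close> ranges over all real numbers, and the infimum is taken in the extended reals,
  where \<open>Inf {} = \<infinity>\<close>. The definition is meant for \<open>x > 0\<close> only, since numerators are
  required to be positive.
\<close>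

definition irrationality_measure :: "real \<Rightarrow> ereal" where
  "irrationality_measure x =
     Inf (ereal ` {m :: real. finite {(p :: nat, q :: nat). p > 0 \<and> q > 0 \<and> coprime p q \<and>
        0 < \<bar>x - real p / real q\<bar> \<and> \<bar>x - real p / real q\<bar> < 1 / real q powr m}})"

end

theory Submission
  imports Defs
begin

text \<open>
  Only the convergence of the terms to \<open>0\<close> is used. If \<open>\<bar>pi - p / q\<bar> < q powr (-5/2)\<close>, then
  \<open>\<bar>sin p\<bar> = \<bar>sin (q * pi - p)\<bar> \<le> q * \<bar>pi - p / q\<bar>\<close> and \<open>p < 5 * q\<close> give \<open>p^3 * (sin p)^2 \<le> 125\<close>, so the
  \<open>p\<close>-th term is at least \<open>1 / 125\<close> and \<open>p\<close> is bounded. This needs \<open>sin p \<noteq> 0\<close>, since \<open>1 / 0 = 0\<close>.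
  Instead of proving that \<open>pi\<close> is irrational, we observe that a rational number has only finitely
  many approximations of exponent \<open>5 / 2\<close>.
\<close>

definition approximations :: "real \<Rightarrow> real \<Rightarrow> (nat \<times> nat) set" where
  "approximations x m = {(p, q). p > 0 \<and> q > 0 \<and> coprime p q \<and>
     0 < \<bar>x - real p / real q\<bar> \<and> \<bar>x - real p / real q\<bar> < 1 / real q powr m}"

lemma irrationality_measure_le:
  assumes "finite (approximations x m)"
  shows "irrationality_measure x \<le> ereal m"
  unfolding irrationality_measure_def
  using assms by (intro Inf_lower) (auto simp: approximations_def)

text \<open>As \<open>q \<ge> 1\<close> and \<open>m \<ge> 0\<close>, the fraction lies within
  distance 1 of \<open>x\<close>. The upper bound limits numerators by denominators; the lower one
  does the converse when \<open>x > 1\<close>.\<close>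

lemma approximations_num_less:
  assumes "(p, q) \<in> approximations x m" "m \<ge> 0"
  shows "real p < (x + 1) * real q" "(x - 1) * real q < real p"
proof -
  have q: "real q \<ge> 1" and d: "\<bar>x - real p / real q\<bar> < 1 / real q powr m"
    using assms(1) by (auto simp: approximations_def)
  have "1 / real q powr m \<le> 1"
    using q assms(2) by (simp add: ge_one_powr_ge_zero)
  with d have "\<bar>x - real p / real q\<bar> < 1" by linarith
  then have "real p / real q < x + 1" "x - 1 < real p / real q" by linarith+
  then show "real p < (x + 1) * real q" "(x - 1) * real q < real p"
    using q by (auto simp: field_simps)
qed

lemma finite_approximations_if_denom_bounded:
  assumes "m \<ge> 0" "\<And>p q. (p, q) \<in> approximations x m \<Longrightarrow> q \<le> B"
  shows "finite (approximations x m)"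
proof (rule finite_subset)
  show "approximations x m \<subseteq> {..nat \<lceil>\<bar>x + 1\<bar> * real B\<rceil>} \<times> {..B}"
  proof safe
    fix p q assume pq: "(p, q) \<in> approximations x m"
    then show q: "q \<le> B" by (rule assms(2))
    have "real p < (x + 1) * real q" using approximations_num_less[OF pq assms(1)] by blast
    \<comment> \<open>The absolute value keeps the factor nonnegative for arbitrary
      \<open>x\<close>.\<close>
    also have "\<dots> \<le> \<bar>x + 1\<bar> * real B" using q by (intro mult_mono) auto
    finally show "p \<le> nat \<lceil>\<bar>x + 1\<bar> * real B\<rceil>" by linarith
  qed
qed simp

text \<open>Squaring turns the exponent 5/2 into 5, so that the later estimates involve only natural
  powers.\<close>

lemma approximations_five_halves:
  assumes "(p, q) \<in> approximations x (5 / 2)"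
  shows "(x - real p / real q)\<^sup>2 * real q ^ 5 < 1"
proof -
  define d where "d = \<bar>x - real p / real q\<bar>"
  have q: "q > 0" and d: "d < 1 / real q powr (5 / 2)" and "d \<ge> 0"
    using assms by (auto simp: approximations_def d_def)
  have "d * real q powr (5 / 2) < 1"
    using d q by (simp add: field_simps)
  then have "(d * real q powr (5 / 2))\<^sup>2 < 1"
    using \<open>d \<ge> 0\<close> by (simp add: power_less_one_iff abs_square_less_1)
  moreover have "(real q powr (5 / 2))\<^sup>2 = real q ^ 5"
    using q by (simp add: powr_powr flip: powr_numeral)
  ultimately show ?thesis
    by (simp add: power_mult_distrib d_def)
qed

text \<open>Distinct fractions with denominators \<open>b\<close> and \<open>q\<close> differ by at
  least \<open>1 / (b * q)\<close>. Compared with the upper bound of order 5/2, this forces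
  \<open>q ^ 3 < b\<^sup>2\<close>.\<close>

lemma finite_approximations_rational:
  assumes "x \<in> \<rat>"
  shows "finite (approximations x (5 / 2))"
proof -
  from assms obtain a :: int and b :: nat where b: "b > 0" and x: "x = of_int a / of_nat b"
    by (metis Rats_cases' of_int_of_nat_eq of_nat_0_less_iff zero_less_imp_eq_int)
  show ?thesis
  proof (rule finite_approximations_if_denom_bounded)
    fix p q assume pq: "(p, q) \<in> approximations x (5 / 2)"
    then have q: "q > 0" and ne: "x - real p / real q \<noteq> 0"
      by (auto simp: approximations_def)
    define k where "k = a * int q - int p * int b"
    have k: "x - real p / real q = of_int k / (real b * real q)"
      using b q by (simp add: k_def x field_simps)
    with ne have "k \<noteq> 0" by auto
    then have "1 \<le> (of_int k :: real)\<^sup>2"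
      by (metis of_int_1_le_iff of_int_power int_one_le_iff_zero_less zero_less_power2)
    then have "real q ^ 3 \<le> (of_int k)\<^sup>2 * real q ^ 3"
      by (simp add: mult_le_cancel_right1)
    also have "\<dots> < (real b)\<^sup>2"
      using approximations_five_halves[OF pq] b q
      by (simp add: k field_simps power_mult_distrib power2_eq_square eval_nat_numeral)
    finally have "q ^ 3 < b\<^sup>2" by (metis of_nat_less_iff of_nat_power)
    moreover have "q \<le> q ^ 3" by (simp add: self_le_power q Suc_leI)
    ultimately show "q \<le> b\<^sup>2" by linarith
  qed simp
qed

lemma abs_sin_nat_le:
  assumes "q > 0"
  shows "\<bar>sin (real p)\<bar> \<le> real q * \<bar>pi - real p / real q\<bar>"
proof -
  \<comment> \<open>Here \<open>sin (q * pi) = 0\<close> and \<open>cos (q * pi)\<close> is 1 or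
    -1.\<close>
  have "\<bar>sin (real p)\<bar> = \<bar>sin (real q * pi - real p)\<bar>"
    by (simp add: sin_diff abs_mult)
  also have "\<dots> \<le> \<bar>real q * pi - real p\<bar>" by (rule abs_sin_x_le_abs_x)
  also have "real q * pi - real p = real q * (pi - real p / real q)"
    using assms by (simp add: field_simps)
  finally show ?thesis by (simp add: abs_mult)
qed

text \<open>A zero of the sine at \<open>p > 0\<close> would be a nonzero integer multiple of
  \<open>pi\<close>, and dividing would make \<open>pi\<close> rational.\<close>

lemma sin_nat_nonzero:
  assumes "pi \<notin> \<rat>" "p > 0"
  shows "sin (real p) \<noteq> 0"
proof
  assume "sin (real p) = 0"
  then obtain i :: int where i: "real p = of_int i * pi" by (auto simp: sin_zero_iff_int2)
  with assms(2) have "i \<noteq> 0" by auto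
  with i have "pi = real p / of_int i" by (simp add: field_simps)
  with assms(1) show False by (metis Rats_divide Rats_of_int Rats_of_nat)
qed

lemma cube_mult_sin_squared_le:
  assumes "(p, q) \<in> approximations pi (5 / 2)"
  shows "real p ^ 3 * (sin (real p))\<^sup>2 \<le> 125"
proof -
  have q: "q > 0" using assms by (auto simp: approximations_def)
  have "real p < (pi + 1) * real q" using approximations_num_less[OF assms] by simp
  \<comment> \<open>The 5 comes from \<open>pi + 1 < 5\<close>; its cube is the final constant
    125.\<close>
  also have "\<dots> \<le> 5 * real q" using pi_less_4 by (intro mult_right_mono) auto
  finally have p: "real p ^ 3 \<le> (5 * real q) ^ 3" by (intro power_mono) auto
  have s: "(sin (real p))\<^sup>2 \<le> (real q * \<bar>pi - real p / real q\<bar>)\<^sup>2"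
    using abs_sin_nat_le[OF q, of p] by (metis abs_ge_zero power2_abs power_mono)
  have "real p ^ 3 * (sin (real p))\<^sup>2 \<le> (5 * real q) ^ 3 * (real q * \<bar>pi - real p / real q\<bar>)\<^sup>2"
    by (intro mult_mono p s) auto
  \<comment> \<open>The exponents 3 and 2 of the series add up to 5, twice the exponent of
    approximation; this is the source of 5/2.\<close>
  also have "\<dots> = 125 * ((pi - real p / real q)\<^sup>2 * real q ^ 5)"
    by (simp add: power_mult_distrib flip: power_add)
  also have "\<dots> \<le> 125"
    using approximations_five_halves[OF assms] by simp
  finally show ?thesis .
qed

theorem corollary4:
  assumes "summable (\<lambda>n :: nat. 1 / (real (Suc n) ^ 3 * (sin (real (Suc n)))\<^sup>2))"
  shows "irrationality_measure pi \<le> ereal (5 / 2)"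
proof (rule irrationality_measure_le, cases "pi \<in> \<rat>")
  case True
  then show "finite (approximations pi (5 / 2))" by (rule finite_approximations_rational)
next
  case False
  from summable_LIMSEQ_zero[OF assms]
  have "\<forall>\<^sub>F n in sequentially. 1 / (real (Suc n) ^ 3 * (sin (real (Suc n)))\<^sup>2) < 1 / 125"
    by (rule order_tendstoD) simp
  then obtain N where
    N: "1 / (real (Suc n) ^ 3 * (sin (real (Suc n)))\<^sup>2) < 1 / 125" if "n \<ge> N" for n
    by (auto simp: eventually_sequentially)
  show "finite (approximations pi (5 / 2))"
  proof (rule finite_approximations_if_denom_bounded)
    fix p q assume pq: "(p, q) \<in> approximations pi (5 / 2)"
    then have "p > 0" by (auto simp: approximations_def)
    \<comment> \<open>Since \<open>pi - 1 \<ge> 1\<close>, denominators stay below numerators, so a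
      bound on \<open>p\<close> also bounds \<open>q\<close>.\<close>
    have "1 * real q \<le> (pi - 1) * real q" using pi_ge_two by (intro mult_right_mono) auto
    also have "\<dots> < real p" using approximations_num_less[OF pq] by simp
    finally have "q < p" by simp
    have "0 < real p ^ 3 * (sin (real p))\<^sup>2"
      using sin_nat_nonzero[OF False \<open>p > 0\<close>] \<open>p > 0\<close> by simp
    then have "1 / 125 \<le> 1 / (real p ^ 3 * (sin (real p))\<^sup>2)"
      using cube_mult_sin_squared_le[OF pq] by (intro divide_left_mono) auto
    \<comment> \<open>The series is indexed from 0, so the term belonging to \<open>p\<close> has
      index \<open>p - 1\<close>.\<close>
    then have "\<not> N \<le> p - 1"
      using N[of "p - 1"] \<open>p > 0\<close> by auto
    with \<open>q < p\<close> show "q \<le> N" by linarith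
  qed simp
qed

end
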